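(* There exists an anti-involution $i$ of $U_{g,h}$ (a $\mathbb{K}$-linear map $i:U_{g,h}\to U_{g,h}$ with $i(1)=1$, $i(ab)=i(b)i(a)$ for all $a,b$, and $i\circ i=\mathrm{id}$) that acts as the identity on all of $\mathbb{K}[K^{\pm1},g^{\pm1},h^{\pm1}]$.
   Context: $\mathbb{K}$ is an algebraically closed field of characteristic zero, and $q\in\mathbb{K}$ is nonzero with $q^2\neq 1$. $U_{g,h}$ is the unital associative $\mathbb{K}$-algebra generated by $E,F,K^{\pm1},g^{\pm1},h^{\pm1}$ with relations: $KK^{-1}=K^{-1}K=gg^{-1}=g^{-1}g=hh^{-1}=h^{-1}h=1$; $g$ and $h$ commute with each other and with $E,F,K$; $KEK^{-1}=q^2E$; $KFK^{-1}=q^{-2}F$; $EF-FE=\frac{K-K^{-1}g^2}{q-q^{-1}}$. Here $\mathbb{K}[K^{\pm1},g^{\pm1},h^{\pm1}]$ is the subalgebra of $U_{g,h}$ generated by $K^{\pm1},g^{\pm1},h^{\pm1}$. *)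

theory Defs
  imports "HOL-Algebra.Algebra" "HOL-Algebra.Algebraic_Closure_Type" "HOL-Library.Poly_Mapping"
begin

text \<open>
  The free monoid on \<open>'a\<close>, with concatenation written additively, because the convolution
  product of \<^typ>\<open>'w \<Rightarrow>\<^sub>0 'k\<close> in \<^theory>\<open>HOL-Library.Poly_Mapping\<close> is
  defined for \<^typ>\<open>'w\<close> of class \<^class>\<open>monoid_add\<close> (which is not assumed commutative).
\<close>

datatype 'a free_monoid = Word (letters: "'a list")

instantiation free_monoid :: (type) monoid_add
begin

definition zero_free_monoid :: "'a free_monoid"
  where "0 = Word []"

definition plus_free_monoid :: "'a free_monoid \<Rightarrow> 'a free_monoid \<Rightarrow> 'a free_monoid"
  where "u + v = Word (letters u @ letters v)"

instance
  by standard (simp_all add: zero_free_monoid_def plus_free_monoid_def)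

end

text \<open>The free associative algebra \<open>'k\<langle>'x\<rangle>\<close> is the monoid algebra of the free monoid.\<close>

type_synonym ('x, 'k) free_alg = "'x free_monoid \<Rightarrow>\<^sub>0 'k"

definition scal :: "'k \<Rightarrow> ('x, 'k::field) free_alg"
  where "scal c = Poly_Mapping.single 0 c"

definition var :: "'x \<Rightarrow> ('x, 'k::field) free_alg"
  where "var x = Poly_Mapping.single (Word [x]) 1"

text \<open>
  A unital associative (not necessarily commutative) algebra over the field \<^typ>\<open>'k\<close> with elements
  in \<^typ>\<open>'a\<close> is represented by a record of type \<^typ>\<open>('k, 'a) module\<close>, every element of
  \<^typ>\<open>'k\<close> being a scalar. The locale \<^locale>\<open>algebra\<close> of HOL-Algebra is not
  usable here, since it only covers commutative algebras.
\<close>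

definition free_algebra :: "('k::field, ('x, 'k) free_alg) module"
  where "free_algebra = ring.extend ring_of_type_algebra (module.fields (\<lambda>c x. scal c * x))"

definition quot_algebra :: "('k, 'a) module \<Rightarrow> 'a set \<Rightarrow> ('k, 'a set) module"
  where "quot_algebra A I = ring.extend (A Quot I)
    (module.fields (\<lambda>c C. \<Union>x\<in>C. I +>\<^bsub>A\<^esub> (c \<odot>\<^bsub>A\<^esub> x)))"

definition generated_subalgebra :: "('k, 'a) module \<Rightarrow> 'a set \<Rightarrow> 'a set"
  where "generated_subalgebra A S =
    \<Inter>{B. subring B A \<and> (\<forall>c. \<forall>x\<in>B. c \<odot>\<^bsub>A\<^esub> x \<in> B) \<and> S \<subseteq> B}"

definition anti_involution :: "('k, 'a) module \<Rightarrow> ('a \<Rightarrow> 'a) \<Rightarrow> bool"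
  where "anti_involution A i \<longleftrightarrow>
    i \<in> carrier A \<rightarrow> carrier A \<and>
    (\<forall>x\<in>carrier A. \<forall>y\<in>carrier A. i (x \<oplus>\<^bsub>A\<^esub> y) = i x \<oplus>\<^bsub>A\<^esub> i y) \<and>
    (\<forall>c. \<forall>x\<in>carrier A. i (c \<odot>\<^bsub>A\<^esub> x) = c \<odot>\<^bsub>A\<^esub> i x) \<and>
    i \<one>\<^bsub>A\<^esub> = \<one>\<^bsub>A\<^esub> \<and>
    (\<forall>x\<in>carrier A. \<forall>y\<in>carrier A. i (x \<otimes>\<^bsub>A\<^esub> y) = i y \<otimes>\<^bsub>A\<^esub> i x) \<and>
    (\<forall>x\<in>carrier A. i (i x) = x)"

datatype gen = gE | gF | gK | gKinv | gg | gginv | gh | ghinv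

text \<open>Each relation \<open>l = r\<close> is recorded as the element \<open>l - r\<close> of the free algebra.\<close>

definition U_relations :: "'k::field \<Rightarrow> (gen, 'k) free_alg set"
  where "U_relations q =
   (let E = var gE; F = var gF; K = var gK; K' = var gKinv;
        g = var gg; g' = var gginv; h = var gh; h' = var ghinv
    in { K * K' - 1, K' * K - 1, g * g' - 1, g' * g - 1, h * h' - 1, h' * h - 1,
         g * h - h * g,
         g * E - E * g, g * F - F * g, g * K - K * g,
         h * E - E * h, h * F - F * h, h * K - K * h,
         K * E * K' - scal (q ^ 2) * E,
         K * F * K' - scal (inverse (q ^ 2)) * F,
         E * F - F * E - scal (inverse (q - inverse q)) * (K - K' * g ^ 2) })"

definition U_ideal :: "'k::field \<Rightarrow> (gen, 'k) free_alg set"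
  where "U_ideal q = Idl\<^bsub>free_algebra :: ('k, (gen, 'k) free_alg) module\<^esub> (U_relations q)"

definition U_alg :: "'k::field \<Rightarrow> ('k, (gen, 'k) free_alg set) module"
  where "U_alg q = quot_algebra free_algebra (U_ideal q)"

definition U_gen :: "'k::field \<Rightarrow> gen \<Rightarrow> (gen, 'k) free_alg set"
  where "U_gen q x = U_ideal q +>\<^bsub>free_algebra :: ('k, (gen, 'k) free_alg) module\<^esub> var x"

text \<open>The unital subalgebra \<open>\<bbbK>[K\<^sup>\<plusminus>\<^sup>1, g\<^sup>\<plusminus>\<^sup>1, h\<^sup>\<plusminus>\<^sup>1]\<close>.\<close>

definition U_torus :: "'k::field \<Rightarrow> (gen, 'k) free_alg set set"
  where "U_torus q =
    generated_subalgebra (U_alg q) (U_gen q ` {gK, gKinv, gg, gginv, gh, ghinv})"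

end

theory Submission
  imports Defs
begin

text \<open>
  The anti-involution exchanges \<open>E\<close> and \<open>F\<close> and fixes \<open>K\<close>, \<open>g\<close>, \<open>h\<close> and their inverses. On
  the free algebra this prescription defines an anti-automorphism \<open>\<phi>\<close> of order two: reverse every
  word and exchange the letters \<open>E\<close> and \<open>F\<close>. It descends to \<open>U\<^sub>g\<^sub>,\<^sub>h\<close> because \<open>\<phi>\<close> sends each
  defining relation into the ideal that the relations generate (\<open>reversal_U_relations\<close>):
  the relations \<open>K E K\<^sup>-\<^sup>1 = q\<^sup>2 E\<close> and \<open>K F K\<^sup>-\<^sup>1 = q\<^sup>-\<^sup>2 F\<close> become
  \<open>K\<^sup>-\<^sup>1 F K = q\<^sup>2 F\<close> and \<open>K\<^sup>-\<^sup>1 E K = q\<^sup>-\<^sup>2 E\<close>, which follow by conjugation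
  with \<open>K\<close> from the original relations for \<open>F\<close> and \<open>E\<close> respectively; and since \<open>\<phi> (E F) = \<phi> F \<phi> E = E F\<close>, the commutator relation
  changes only in that \<open>K\<^sup>-\<^sup>1 g\<^sup>2\<close> turns into \<open>g\<^sup>2 K\<^sup>-\<^sup>1\<close>, which is the same element because \<open>g\<close> is
  central. The induced map on cosets is the image map under \<open>\<phi>\<close>
  (\<open>anti_involution_quotient\<close>).

  The fixed points of an anti-homomorphism need not form a subalgebra, so fixing the generators of
  the torus is not by itself enough. The generators commute with each other, hence the subalgebra
  generated by them is commutative, and inside a commutative subalgebra the fixed points are again
  a subalgebra (\<open>anti_involution_fixes_generated_subalgebra\<close>).
\<close>

section \<open>Associative algebras and generated subalgebras\<close>

text \<open>
  The axioms record exactly what makes centralizers closed under scalars: a scalar moves freely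
  through either factor of a product.
\<close>

locale assoc_algebra = ring A for A :: "('k, 'a) module" (structure) +
  assumes smult_closed [simp, intro]: "x \<in> carrier A \<Longrightarrow> c \<odot> x \<in> carrier A"
    and smult_mult_left: "x \<in> carrier A \<Longrightarrow> y \<in> carrier A \<Longrightarrow> (c \<odot> x) \<otimes> y = c \<odot> (x \<otimes> y)"
    and smult_mult_right: "x \<in> carrier A \<Longrightarrow> y \<in> carrier A \<Longrightarrow> x \<otimes> (c \<odot> y) = c \<odot> (x \<otimes> y)"
begin

definition subalgebra :: "'a set \<Rightarrow> bool"
  where "subalgebra B \<longleftrightarrow> subring B A \<and> (\<forall>c. \<forall>x\<in>B. c \<odot> x \<in> B)"

lemma generated_subalgebra_least:
  assumes "subalgebra B" "S \<subseteq> B"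
  shows "generated_subalgebra A S \<subseteq> B"
  using assms unfolding generated_subalgebra_def subalgebra_def by blast

lemma generators_in_generated_subalgebra: "S \<subseteq> generated_subalgebra A S"
  unfolding generated_subalgebra_def by blast

lemma subalgebra_carrier: "subalgebra (carrier A)"
  by (simp add: subalgebra_def carrier_is_subring)

lemma subalgebra_generated:
  assumes "S \<subseteq> carrier A"
  shows "subalgebra (generated_subalgebra A S)"
proof -
  have "carrier A \<in> {B. subring B A \<and> (\<forall>c. \<forall>x\<in>B. c \<odot> x \<in> B) \<and> S \<subseteq> B}"
    using assms subalgebra_carrier by (simp add: subalgebra_def)
  then have "subring (generated_subalgebra A S) A"
    unfolding generated_subalgebra_def by (intro subring_Inter) auto
  moreover have "\<forall>c. \<forall>x\<in>generated_subalgebra A S. c \<odot> x \<in> generated_subalgebra A S"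
    unfolding generated_subalgebra_def by blast
  ultimately show ?thesis by (simp add: subalgebra_def)
qed

lemma subalgebra_centralizer:
  assumes "S \<subseteq> carrier A"
  shows "subalgebra {x \<in> carrier A. \<forall>s\<in>S. x \<otimes> s = s \<otimes> x}"
proof -
  have "subring {x \<in> carrier A. \<forall>s\<in>S. x \<otimes> s = s \<otimes> x} A"
  proof (rule subringI)
    fix x y
    assume x: "x \<in> {x \<in> carrier A. \<forall>s\<in>S. x \<otimes> s = s \<otimes> x}"
      and y: "y \<in> {x \<in> carrier A. \<forall>s\<in>S. x \<otimes> s = s \<otimes> x}"
    have "x \<otimes> y \<otimes> s = s \<otimes> (x \<otimes> y)" if "s \<in> S" for s
    proof -
      have "s \<in> carrier A" using assms that by blast
      then have "x \<otimes> y \<otimes> s = x \<otimes> (s \<otimes> y)" using x y that by (simp add: m_assoc)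
      also have "\<dots> = s \<otimes> x \<otimes> y" using x y that \<open>s \<in> carrier A\<close> by (simp add: m_assoc[symmetric])
      finally show ?thesis using x y \<open>s \<in> carrier A\<close> by (simp add: m_assoc)
    qed
    with x y show "x \<otimes> y \<in> {x \<in> carrier A. \<forall>s\<in>S. x \<otimes> s = s \<otimes> x}" by simp
    show "x \<oplus> y \<in> {x \<in> carrier A. \<forall>s\<in>S. x \<otimes> s = s \<otimes> x}"
      using x y assms by (auto simp: l_distr r_distr subset_iff)
  qed (use assms in \<open>auto simp: l_minus r_minus subset_iff\<close>)
  then show ?thesis
    using assms by (auto simp: subalgebra_def smult_mult_left smult_mult_right subset_iff)
qed

text \<open>
  The centralizer of \<open>S\<close> is a subalgebra that contains \<open>S\<close>, hence all of the subalgebra \<open>B\<close> generated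
  by \<open>S\<close>. So the centralizer of \<open>B\<close> also contains \<open>S\<close>, and therefore \<open>B\<close>.
\<close>

lemma generated_subalgebra_commutative:
  assumes "S \<subseteq> carrier A" and comm: "\<And>s t. s \<in> S \<Longrightarrow> t \<in> S \<Longrightarrow> s \<otimes> t = t \<otimes> s"
    and "x \<in> generated_subalgebra A S" "y \<in> generated_subalgebra A S"
  shows "x \<otimes> y = y \<otimes> x"
proof -
  let ?B = "generated_subalgebra A S"
  have carr: "?B \<subseteq> carrier A"
    by (rule generated_subalgebra_least[OF subalgebra_carrier assms(1)])
  have "?B \<subseteq> {x \<in> carrier A. \<forall>s\<in>S. x \<otimes> s = s \<otimes> x}"
    by (rule generated_subalgebra_least[OF subalgebra_centralizer[OF assms(1)]])
       (use assms(1) comm in auto)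
  then have "S \<subseteq> {x \<in> carrier A. \<forall>b\<in>?B. x \<otimes> b = b \<otimes> x}"
    using assms(1) by (fastforce simp: subset_iff)
  then have "?B \<subseteq> {x \<in> carrier A. \<forall>b\<in>?B. x \<otimes> b = b \<otimes> x}"
    by (rule generated_subalgebra_least[OF subalgebra_centralizer[OF carr]])
  then show ?thesis using assms(3,4) by blast
qed

text \<open>
  The product of two fixed points is sent to the product in the opposite order. Hence the induction
  over the generated subalgebra runs over the fixed points that lie in it, where factors commute.
\<close>

lemma anti_involution_fixes_generated_subalgebra:
  assumes i: "anti_involution A i"
    and S: "S \<subseteq> carrier A" and comm: "\<And>s t. s \<in> S \<Longrightarrow> t \<in> S \<Longrightarrow> s \<otimes> t = t \<otimes> s"
    and fixed: "\<And>s. s \<in> S \<Longrightarrow> i s = s"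
    and x: "x \<in> generated_subalgebra A S"
  shows "i x = x"
proof -
  let ?B = "generated_subalgebra A S" and ?F = "{x \<in> generated_subalgebra A S. i x = x}"
  have i_closed: "i x \<in> carrier A" if "x \<in> carrier A" for x
    using i that by (auto simp: anti_involution_def)
  have i_add: "i (x \<oplus> y) = i x \<oplus> i y" if "x \<in> carrier A" "y \<in> carrier A" for x y
    using i that by (simp add: anti_involution_def)
  have i_mult: "i (x \<otimes> y) = i y \<otimes> i x" if "x \<in> carrier A" "y \<in> carrier A" for x y
    using i that by (simp add: anti_involution_def)
  have i_zero: "i \<zero> = \<zero>"
  proof -
    have "i \<zero> \<oplus> i \<zero> = i \<zero> \<oplus> \<zero>" using i_add[of \<zero> \<zero>] i_closed[of \<zero>] by simp
    then show ?thesis using i_closed[of \<zero>] add.l_cancel by blast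
  qed
  have i_minus: "i (\<ominus> x) = \<ominus> i x" if "x \<in> carrier A" for x
    using i_add[of "\<ominus> x" x] that i_zero i_closed by (simp add: l_neg minus_equality)
  have alg: "subalgebra ?B" by (rule subalgebra_generated[OF S])
  then have sub: "subring ?B A" by (simp add: subalgebra_def)
  note B = subringE[OF sub]
  have carr: "b \<in> carrier A" if "b \<in> ?B" for b using B(1) that by blast
  have "subring ?F A"
  proof (rule subringI)
    show "\<one> \<in> ?F" using i B(3) by (simp add: anti_involution_def)
  next
    fix x y assume x: "x \<in> ?F" and y: "y \<in> ?F"
    then have "i (x \<otimes> y) = y \<otimes> x" using i_mult carr by simp
    also have "\<dots> = x \<otimes> y"
      using generated_subalgebra_commutative[OF S comm] x y by blast
    finally show "x \<otimes> y \<in> ?F" using x y B(6) by simp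
    show "x \<oplus> y \<in> ?F" using x y B(7) i_add carr by simp
  qed (use B(1,5) i_minus carr in auto)
  moreover have "\<forall>c. \<forall>x\<in>?F. c \<odot> x \<in> ?F"
    using alg i carr by (simp add: subalgebra_def anti_involution_def)
  ultimately have "subalgebra ?F" by (simp add: subalgebra_def)
  then have "?B \<subseteq> ?F"
    by (rule generated_subalgebra_least) (use generators_in_generated_subalgebra fixed in auto)
  then show ?thesis using x by blast
qed

end

section \<open>Quotients of the free algebra\<close>

lemma poly_mapping_induct_single [case_names zero add]:
  assumes "P 0" and "\<And>p k v. P p \<Longrightarrow> P (p + Poly_Mapping.single k v)"
  shows "P (p :: 'a \<Rightarrow>\<^sub>0 'b::monoid_add)"
proof (induction p rule: update_induct)
  case const
  then show ?case using assms(1) by simp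
next
  case (update p k v)
  have "Poly_Mapping.update k v p = p + Poly_Mapping.single k v"
    using update(1) by (intro poly_mapping_eqI)
      (auto simp: lookup_update lookup_add lookup_single when_def in_keys_iff)
  then show ?case using assms(2) update by simp
qed

lemma scal_central: "scal c * p = p * (scal c :: ('x, 'k::field) free_alg)"
  by (induction p rule: poly_mapping_induct_single)
     (simp_all add: scal_def mult_single algebra_simps)

lemma free_algebra_simps [simp]:
  "carrier (free_algebra :: ('k::field, ('x, 'k) free_alg) module) = UNIV"
  "monoid.mult (free_algebra :: ('k::field, ('x, 'k) free_alg) module) = (*)"
  "monoid.one (free_algebra :: ('k::field, ('x, 'k) free_alg) module) = 1"
  "ring.zero (free_algebra :: ('k::field, ('x, 'k) free_alg) module) = 0"
  "ring.add (free_algebra :: ('k::field, ('x, 'k) free_alg) module) = (+)"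
  "module.smult (free_algebra :: ('k::field, ('x, 'k) free_alg) module) = (\<lambda>c x. scal c * x)"
  by (simp_all add: free_algebra_def ring_of_type_algebra_def ring.defs module.defs fun_eq_iff)

lemma ring_free_algebra: "ring (free_algebra :: ('k::field, ('x, 'k) free_alg) module)"
proof -
  have "\<exists>y. x + y = 0 \<and> y + x = 0" for x :: "('x, 'k) free_alg"
    by (rule exI[of _ "- x"]) simp
  then show ?thesis
    by unfold_locales (auto simp: algebra_simps Units_def)
qed

lemma a_inv_free_algebra [simp]:
  "a_inv (free_algebra :: ('k::field, ('x, 'k) free_alg) module) x = - x"
proof -
  interpret ring "free_algebra :: ('k, ('x, 'k) free_alg) module" by (rule ring_free_algebra)
  show ?thesis by (rule minus_equality) simp_all
qed

locale free_algebra_ideal = ideal J "free_algebra :: ('k::field, ('x, 'k) free_alg) module"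
  for J :: "('x, 'k::field) free_alg set"
begin

abbreviation coset :: "('x, 'k) free_alg \<Rightarrow> ('x, 'k) free_alg set"
  where "coset x \<equiv> J +>\<^bsub>free_algebra :: ('k, ('x, 'k) free_alg) module\<^esub> x"

abbreviation Q :: "('k, ('x, 'k) free_alg set) module"
  where "Q \<equiv> quot_algebra free_algebra J"

lemma add_mem: "x \<in> J \<Longrightarrow> y \<in> J \<Longrightarrow> x + y \<in> J"
  using additive_subgroup.a_closed[OF is_additive_subgroup] by simp

lemma minus_mem: "x \<in> J \<Longrightarrow> - x \<in> J"
  using additive_subgroup.a_inv_closed[OF is_additive_subgroup] by simp

lemma diff_mem: "x \<in> J \<Longrightarrow> y \<in> J \<Longrightarrow> x - y \<in> J"
  using add_mem[OF _ minus_mem, of x y] by simp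

lemma mult_mem: "y \<in> J \<Longrightarrow> x * y \<in> J" "y \<in> J \<Longrightarrow> y * x \<in> J"
  using I_l_closed I_r_closed by simp_all

lemma mem_coset_iff: "y \<in> coset x \<longleftrightarrow> y - x \<in> J"
  using a_rcos_module[of x y] by simp

lemma coset_eq_iff: "coset x = coset y \<longleftrightarrow> x - y \<in> J"
  using quotient_eq_iff_same_a_r_cos[OF ideal_axioms, of x y] by (simp add: a_minus_def)

lemma Q_fields:
  "carrier Q = range coset"
  "monoid.mult Q (coset x) (coset y) = coset (x * y)"
  "monoid.one Q = coset 1"
  "ring.add Q (coset x) (coset y) = coset (x + y)"
  using rcoset_mult_add a_rcos_sum
  by (auto simp: quot_algebra_def ring.defs module.defs FactRing_def A_RCOSETS_def RCOSETS_def
      a_r_coset_def)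

text \<open>
  In \<^const>\<open>quot_algebra\<close> a scalar multiple of a coset is a union over all representatives; the
  united cosets all coincide, so one representative determines it.
\<close>

lemma smult_coset: "module.smult Q c (coset x) = coset (scal c * x)"
proof -
  have const: "coset (scal c * y) = coset (scal c * x)" if "y \<in> coset x" for y
    using that mult_mem(1)[of "y - x" "scal c"]
    by (simp add: coset_eq_iff mem_coset_iff right_diff_distrib)
  have "module.smult Q c (coset x) = (\<Union>y\<in>coset x. coset (scal c * y))"
    by (simp add: quot_algebra_def ring.defs module.defs)
  also have "\<dots> = (\<Union>y\<in>coset x. coset (scal c * x))"
    by (rule SUP_cong[OF refl const])
  also have "\<dots> = coset (scal c * x)"
    using a_rcos_self[of x] by (intro SUP_const) auto
  finally show ?thesis .
qed

lemma assoc_algebra_Q: "assoc_algebra Q"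
proof -
  interpret quot: ring "free_algebra Quot J" by (rule quotient_is_ring)
  have Q: "carrier Q = carrier (free_algebra Quot J)" "monoid.mult Q = monoid.mult (free_algebra Quot J)"
    "monoid.one Q = monoid.one (free_algebra Quot J)" "ring.add Q = ring.add (free_algebra Quot J)"
    "ring.zero Q = ring.zero (free_algebra Quot J)"
    by (simp_all add: quot_algebra_def ring.defs module.defs)
  have "ring Q"
  proof (rule ringI)
    show "abelian_group Q"
      by (rule abelian_groupI) 
        (auto simp: Q quot.a_ac intro: quot.add.l_inv_ex)
    show "Group.monoid Q"
      by (rule monoidI) (auto simp: Q quot.m_assoc)
  qed (auto simp: Q quot.l_distr quot.r_distr)
  then interpret Q: ring Q .
  have comm: "x * (scal c * y) = scal c * (x * y)" for c and x y :: "('x, 'k) free_alg"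
    by (metis mult.assoc scal_central)
  show ?thesis
    by unfold_locales (auto simp: Q_fields smult_coset mult.assoc comm)
qed

end

section \<open>Word reversal\<close>

definition reverse_word :: "('x \<Rightarrow> 'x) \<Rightarrow> 'x free_monoid \<Rightarrow> 'x free_monoid"
  where "reverse_word \<sigma> w = Word (map \<sigma> (rev (letters w)))"

text \<open>
  \<^const>\<open>Poly_Mapping.map_key\<close> composes the coefficient function with \<open>reverse_word \<sigma>\<close>. In general this
  is the pullback of words; for an involution \<open>\<sigma>\<close> the map on words is its own inverse, and the result
  is the linear extension of \<open>reverse_word \<sigma>\<close>.
\<close>

definition reversal :: "('x \<Rightarrow> 'x) \<Rightarrow> ('x, 'k::field) free_alg \<Rightarrow> ('x, 'k) free_alg"
  where "reversal \<sigma> p = Poly_Mapping.map_key (reverse_word \<sigma>) p"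

locale letter_involution =
  fixes \<sigma> :: "'x \<Rightarrow> 'x"
  assumes involution: "\<sigma> (\<sigma> x) = x"
begin

lemma reverse_word_involution: "reverse_word \<sigma> (reverse_word \<sigma> w) = w"
  by (cases w) (simp add: reverse_word_def rev_map involution comp_def)

lemma inj_reverse_word: "inj (reverse_word \<sigma>)"
  by (metis injI reverse_word_involution)

lemma reverse_word_add: "reverse_word \<sigma> (u + v) = reverse_word \<sigma> v + reverse_word \<sigma> u"
  by (simp add: reverse_word_def plus_free_monoid_def)

lemma reversal_single:
  "reversal \<sigma> (Poly_Mapping.single w c) = Poly_Mapping.single (reverse_word \<sigma> w) c"
  using map_key_single[OF inj_reverse_word, of "reverse_word \<sigma> w" c]
  by (simp add: reversal_def reverse_word_involution)

lemma reversal_add: "reversal \<sigma> (x + y) = reversal \<sigma> x + reversal \<sigma> y"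
  by (simp add: reversal_def map_key_plus[OF inj_reverse_word])

lemma reversal_zero: "reversal \<sigma> 0 = 0"
  by (simp add: reversal_def map_key_zero[OF inj_reverse_word])

lemma reversal_diff: "reversal \<sigma> (x - y) = reversal \<sigma> x - reversal \<sigma> y"
  using reversal_add[of "x - y" y] by simp

lemma reversal_minus: "reversal \<sigma> (- x) = - reversal \<sigma> x"
  using reversal_diff[of 0 x] by (simp add: reversal_zero)

lemma reversal_scal: "reversal \<sigma> (scal c) = scal c"
  by (simp add: scal_def reversal_single reverse_word_def zero_free_monoid_def)

lemma reversal_one: "reversal \<sigma> 1 = 1"
  using reversal_scal[of 1] by (simp add: scal_def)

lemma reversal_var: "reversal \<sigma> (var x) = var (\<sigma> x)"
  by (simp add: var_def reversal_single reverse_word_def)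

lemma reversal_mult: "reversal \<sigma> (x * y) = reversal \<sigma> y * reversal \<sigma> x"
proof (induction x rule: poly_mapping_induct_single)
  case zero
  then show ?case by (simp add: reversal_zero)
next
  case (add x u c)
  have "reversal \<sigma> (Poly_Mapping.single u c * y)
      = reversal \<sigma> y * reversal \<sigma> (Poly_Mapping.single u c)"
    by (induction y rule: poly_mapping_induct_single)
       (simp_all add: reversal_zero reversal_add reversal_single mult_single reverse_word_add
          algebra_simps)
  with add show ?case by (simp add: reversal_add algebra_simps)
qed

lemma reversal_involution: "reversal \<sigma> (reversal \<sigma> x) = x"
  by (induction x rule: poly_mapping_induct_single)
     (simp_all add: reversal_zero reversal_add reversal_single reverse_word_involution)

text \<open>
  The preimage of a left ideal under an anti-homomorphism is a right ideal and conversely, so the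
  preimage of a two-sided ideal is again two-sided.
\<close>

lemma ideal_vimage_reversal:
  assumes "ideal J (free_algebra :: ('k::field, ('x, 'k) free_alg) module)"
  shows "ideal (reversal \<sigma> -` J) (free_algebra :: ('k, ('x, 'k) free_alg) module)"
proof -
  let ?A = "free_algebra :: ('k, ('x, 'k) free_alg) module"
  interpret free_algebra_ideal J using assms by (simp add: free_algebra_ideal_def)
  show ?thesis
  proof (rule idealI[OF ring_free_algebra])
    show "subgroup (reversal \<sigma> -` J) (add_monoid ?A)"
    proof (rule add.subgroupI)
      show "reversal \<sigma> -` J \<noteq> {}" using additive_subgroup.zero_closed[OF is_additive_subgroup] reversal_zero by fastforce
    qed (auto simp: reversal_add reversal_minus add_mem minus_mem simp flip: a_inv_def)
  qed (auto simp: reversal_mult mult_mem)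
qed

text \<open>
  The preimage of \<open>J\<close> under the reversal is an ideal containing \<open>R\<close>, hence contains \<open>J\<close>; so the
  reversal maps \<open>J\<close> into itself. Being its own inverse, it maps \<open>J\<close> onto \<open>J\<close>, and therefore cosets
  of \<open>J\<close> onto cosets of \<open>J\<close>. The induced map is thus simply the image of sets.
\<close>

lemma anti_involution_quotient:
  fixes R :: "('x, 'k::field) free_alg set"
  defines "J \<equiv> Idl\<^bsub>free_algebra :: ('k, ('x, 'k) free_alg) module\<^esub> R"
  assumes R: "\<And>r. r \<in> R \<Longrightarrow> reversal \<sigma> r \<in> J"
  shows "anti_involution (quot_algebra free_algebra J) ((`) (reversal \<sigma>))"
    and "reversal \<sigma> ` (J +>\<^bsub>free_algebra :: ('k, ('x, 'k) free_alg) module\<^esub> x)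
      = J +>\<^bsub>free_algebra :: ('k, ('x, 'k) free_alg) module\<^esub> reversal \<sigma> x"
proof -
  interpret ring "free_algebra :: ('k, ('x, 'k) free_alg) module" by (rule ring_free_algebra)
  have J: "ideal J (free_algebra :: ('k, ('x, 'k) free_alg) module)"
    unfolding J_def by (rule genideal_ideal) simp
  interpret free_algebra_ideal J using J by (simp add: free_algebra_ideal_def)
  have "J \<subseteq> reversal \<sigma> -` J"
    using genideal_minimal[OF ideal_vimage_reversal[OF J], of R] R by (auto simp: J_def)
  then have stable: "reversal \<sigma> x \<in> J" if "x \<in> J" for x using that by blast
  have image: "reversal \<sigma> ` coset x = coset (reversal \<sigma> x)" for x
  proof (intro Set.set_eqI iffI)
    fix y assume "y \<in> reversal \<sigma> ` coset x"
    then show "y \<in> coset (reversal \<sigma> x)"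
      using stable by (auto simp: mem_coset_iff simp flip: reversal_diff)
  next
    fix y assume "y \<in> coset (reversal \<sigma> x)"
    then have "reversal \<sigma> y \<in> coset x"
      using stable[of "y - reversal \<sigma> x"]
      by (simp add: mem_coset_iff reversal_diff reversal_involution)
    then show "y \<in> reversal \<sigma> ` coset x"
      by (metis image_eqI reversal_involution)
  qed
  show "anti_involution Q ((`) (reversal \<sigma>))"
    by (auto simp: anti_involution_def Q_fields smult_coset image reversal_add reversal_mult
        reversal_scal reversal_one reversal_involution scal_central)
  show "reversal \<sigma> ` coset x = coset (reversal \<sigma> x)" by (rule image)
qed

end

section \<open>The algebra \<open>U\<^sub>g\<^sub>,\<^sub>h\<close>\<close>

fun swap_EF :: "gen \<Rightarrow> gen"
  where "swap_EF gE = gF" | "swap_EF gF = gE" | "swap_EF x = x"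

interpretation swap_EF: letter_involution swap_EF
proof
  show "swap_EF (swap_EF x) = x" for x by (cases x) simp_all
qed

lemma ideal_U_ideal: "free_algebra_ideal (U_ideal q)"
proof -
  interpret ring "free_algebra :: ('k::field, (gen, 'k) free_alg) module"
    by (rule ring_free_algebra)
  show ?thesis unfolding free_algebra_ideal_def U_ideal_def by (rule genideal_ideal) simp
qed

lemma U_relations_subset_U_ideal: "U_relations q \<subseteq> U_ideal q"
proof -
  interpret ring "free_algebra :: ('k::field, (gen, 'k) free_alg) module"
    by (rule ring_free_algebra)
  show ?thesis unfolding U_ideal_def by (rule genideal_self) simp
qed

text \<open>
  Modulo \<open>J\<close>, \<open>v\<close> is an inverse of \<open>u\<close>: multiplying \<open>x u = u x\<close> by \<open>v\<close> on both sides gives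
  \<open>v x = x v\<close>.
\<close>

lemma (in free_algebra_ideal) inverse_commutes:
  assumes "u * v - 1 \<in> J" "v * u - 1 \<in> J" "x * u - u * x \<in> J"
  shows "x * v - v * x \<in> J"
proof -
  have "x * v - v * x = v * x * (u * v - 1) - v * (x * u - u * x) * v - (v * u - 1) * x * v"
    by (simp add: algebra_simps)
  then show ?thesis using assms by (simp add: add_mem diff_mem mult_mem)
qed

lemma (in free_algebra_ideal) commutes_sym: "x * y - y * x \<in> J \<Longrightarrow> y * x - x * y \<in> J"
  using minus_mem[of "x * y - y * x"] by simp

text \<open>
  Modulo \<open>J\<close>, this conjugates \<open>u x u\<^sup>-\<^sup>1 = c\<^sup>-\<^sup>1 x\<close> back by \<open>u\<close>. With \<open>u = K\<close> it turns the relation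
  for \<open>F\<close> into the image of the relation for \<open>E\<close> under reversal, and conversely.
\<close>

lemma (in free_algebra_ideal) twisted_commutation_reversed:
  assumes "u * v - 1 \<in> J" "v * u - 1 \<in> J" "u * x * v - scal (inverse c) * x \<in> J" "c \<noteq> 0"
  shows "v * x * u - scal c * x \<in> J"
proof -
  have c: "scal c * scal (inverse c) = (1 :: ('x, 'k) free_alg)"
    using assms(4) by (simp add: scal_def mult_single)
  \<comment> \<open>Multiplied by \<open>- scal c\<close>, the hypothesis conjugated by \<open>u\<close> is \<open>v * x * u\<close> minus
    \<open>scal c * (v * u * x * v * u)\<close>; the first summand cancels the two factors \<open>v * u\<close> one by one.\<close>
  have "v * x * u - scal c * x = scal c * ((v * u - 1) * x * v * u + x * (v * u - 1))
      - scal c * (v * (u * x * v - scal (inverse c) * x) * u)"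
  proof -
    have "scal c * (v * (scal (inverse c) * x) * u) = v * x * u"
    proof -
      have "v * (scal (inverse c) * x) = scal (inverse c) * (v * x)"
        by (simp add: scal_central mult.assoc[symmetric]) (metis mult.assoc scal_central)
      then show ?thesis using c by (simp add: mult.assoc[symmetric])
    qed
    then show ?thesis by (simp add: algebra_simps)
  qed
  then show ?thesis using assms by (simp add: add_mem diff_mem mult_mem)
qed

text \<open>
  The hypothesis \<open>q \<noteq> 0\<close> enters in the two relations for conjugation by \<open>K\<close>, where the scalars
  \<open>q\<^sup>2\<close> and \<open>q\<^sup>-\<^sup>2\<close> have to be inverse to each other.
\<close>

lemma reversal_U_relations:
  fixes q :: "'k::field"
  assumes "q \<noteq> 0" "r \<in> U_relations q"
  shows "reversal swap_EF r \<in> U_ideal q"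
proof -
  interpret free_algebra_ideal "U_ideal q" by (rule ideal_U_ideal)
  let ?J = "U_ideal q"
  note rel = U_relations_subset_U_ideal[of q, unfolded U_relations_def Let_def, simplified]
  let ?c = "scal (inverse (q - inverse q)) :: (gen, 'k) free_alg"
  have K'_g: "var gg * var gKinv - var gKinv * var gg \<in> ?J"
    by (rule inverse_commutes[of "var gK"]) (use rel in auto)
  have "var gKinv * var gg ^ 2 - var gg ^ 2 * var gKinv =
      - ((var gg * var gKinv - var gKinv * var gg) * var gg
        + var gg * (var gg * var gKinv - var gKinv * var gg))"
    by (simp add: algebra_simps power2_eq_square)
  then have K'_g2: "var gKinv * var gg ^ 2 - var gg ^ 2 * var gKinv \<in> ?J"
    using K'_g by (metis add_mem minus_mem mult_mem)
  have EF: "var gE * var gF - var gF * var gE - (var gK - var gg ^ 2 * var gKinv) * ?c \<in> ?J"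
  proof -
    have "var gE * var gF - var gF * var gE - (var gK - var gg ^ 2 * var gKinv) * ?c =
        (var gE * var gF - var gF * var gE - ?c * (var gK - var gKinv * var gg ^ 2))
        - ?c * (var gKinv * var gg ^ 2 - var gg ^ 2 * var gKinv)"
      unfolding scal_central[symmetric] by (simp add: algebra_simps)
    moreover have "\<dots> \<in> ?J"
      by (rule diff_mem[OF _ mult_mem(1)[OF K'_g2]]) (simp add: rel)
    ultimately show ?thesis by (simp only:)
  qed
  have KF: "var gKinv * (var gF * var gK) - var gF * scal (q ^ 2) \<in> ?J"
    using twisted_commutation_reversed[of "var gK" "var gKinv" "var gF" "q ^ 2"] rel assms(1)
    by (simp add: mult.assoc scal_central)
  have KE: "var gKinv * (var gE * var gK) - var gE * scal (inverse (q ^ 2)) \<in> ?J"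
    using twisted_commutation_reversed[of "var gK" "var gKinv" "var gE" "inverse (q ^ 2)"] rel
      assms(1)
    by (simp add: mult.assoc scal_central)
  have central: "var gh * var gg - var gg * var gh \<in> ?J"
    "var gE * var gg - var gg * var gE \<in> ?J" "var gE * var gh - var gh * var gE \<in> ?J"
    "var gF * var gg - var gg * var gF \<in> ?J" "var gF * var gh - var gh * var gF \<in> ?J"
    "var gK * var gg - var gg * var gK \<in> ?J" "var gK * var gh - var gh * var gK \<in> ?J"
    by (rule commutes_sym; simp add: rel)+
  have "reversal swap_EF ` U_relations q \<subseteq> ?J"
    using rel EF KF KE central unfolding U_relations_def Let_def
    by (simp add: swap_EF.reversal_diff swap_EF.reversal_mult swap_EF.reversal_var
        swap_EF.reversal_one swap_EF.reversal_scal power2_eq_square mult.assoc)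
  then show ?thesis using assms(2) by blast
qed

text \<open>
  The relations give commutation of \<open>K\<close>, \<open>g\<close> and \<open>h\<close> only; \<open>inverse_commutes\<close> adds the inverses,
  applied once in each of the two arguments.
\<close>

lemma torus_generators_commute:
  assumes "x \<in> {gK, gKinv, gg, gginv, gh, ghinv}" "y \<in> {gK, gKinv, gg, gginv, gh, ghinv}"
  shows "var x * var y - var y * var x \<in> U_ideal (q::'k::field)"
proof -
  interpret free_algebra_ideal "U_ideal q" by (rule ideal_U_ideal)
  note rel = U_relations_subset_U_ideal[of q, unfolded U_relations_def Let_def, simplified]
  have inverses: "(u, v) \<in> {(gK, gKinv), (gg, gginv), (gh, ghinv)} \<Longrightarrow>
      var u * var v - 1 \<in> U_ideal q \<and> var v * var u - 1 \<in> U_ideal q" for u v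
    using rel by auto
  have base: "var x * var y - var y * var x \<in> U_ideal q"
    if "x \<in> {gK, gg, gh}" "y \<in> {gK, gg, gh}" for x y
    using that rel commutes_sym additive_subgroup.zero_closed[OF is_additive_subgroup] by auto
  have right: "var x * var y - var y * var x \<in> U_ideal q"
    if "x \<in> {gK, gg, gh}" "y \<in> {gK, gKinv, gg, gginv, gh, ghinv}" for x y
    using that base inverse_commutes[of "var gK" "var gKinv" "var x"]
      inverse_commutes[of "var gg" "var gginv" "var x"]
      inverse_commutes[of "var gh" "var ghinv" "var x"] inverses
    by auto
  have left: "var y * var x - var x * var y \<in> U_ideal q"
    if "x \<in> {gK, gg, gh}" "y \<in> {gK, gKinv, gg, gginv, gh, ghinv}" for x y
    using right[OF that] by (rule commutes_sym)
  show ?thesis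
    using assms left[of _ x] inverse_commutes[of "var gK" "var gKinv" "var x"]
      inverse_commutes[of "var gg" "var gginv" "var x"]
      inverse_commutes[of "var gh" "var ghinv" "var x"] inverses
    by auto
qed

theorem proposition2p5:
  fixes q :: "'k::{alg_closed_field, field_char_0}"
  assumes "q \<noteq> 0" and "q ^ 2 \<noteq> 1"
  shows "\<exists>i. anti_involution (U_alg q) i \<and> (\<forall>x\<in>U_torus q. i x = x)"
proof -
  interpret free_algebra_ideal "U_ideal q" by (rule ideal_U_ideal)
  interpret U: assoc_algebra "U_alg q" unfolding U_alg_def by (rule assoc_algebra_Q)
  let ?T = "{gK, gKinv, gg, gginv, gh, ghinv}"
  let ?i = "(`) (reversal swap_EF)"
  note quotient = swap_EF.anti_involution_quotient[of "U_relations q", folded U_ideal_def,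
      OF reversal_U_relations[OF assms(1)]]
  have anti: "anti_involution (U_alg q) ?i"
    using quotient(1) by (simp add: U_alg_def)
  have "?i x = x" if "x \<in> U_torus q" for x
  proof (rule U.anti_involution_fixes_generated_subalgebra[OF anti])
    show "x \<in> generated_subalgebra (U_alg q) (U_gen q ` ?T)"
      using that by (simp add: U_torus_def)
    show "U_gen q ` ?T \<subseteq> carrier (U_alg q)"
      unfolding U_alg_def U_gen_def Q_fields by blast
    show "s \<otimes>\<^bsub>U_alg q\<^esub> t = t \<otimes>\<^bsub>U_alg q\<^esub> s" if st: "s \<in> U_gen q ` ?T" "t \<in> U_gen q ` ?T" for s t
    proof -
      obtain a b where ab: "a \<in> ?T" "b \<in> ?T" "s = U_gen q a" "t = U_gen q b" using st by blast
      then show ?thesis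
        using torus_generators_commute[OF ab(1,2), of q]
        by (simp add: U_alg_def U_gen_def Q_fields coset_eq_iff)
    qed
    show "?i s = s" if s_in: "s \<in> U_gen q ` ?T" for s
    proof -
      obtain a where "a \<in> ?T" and s: "s = U_gen q a" using s_in by blast
      then have "swap_EF a = a" by auto
      then show ?thesis by (simp only: s U_gen_def quotient(2) swap_EF.reversal_var)
    qed
  qed
  with anti show ?thesis by blast
qed

end
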